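(* For all integers $a,b\geq 1$, the set of return words of $1$ in $\mathfrak{F}^{(a,b)}$ is exactly $\{\,1\,0^a,\ 1\,0^{a+1}\,\}$.
   Context: Words are over the alphabet $\{0,1\}$; $0^k$ is the word of $k$ zeros. For integers $a,b\geq 1$ let $\mathfrak{F}^{(a,b)}_0=1$, $\mathfrak{F}^{(a,b)}_1=0$, and for $n\geq 2$: $\mathfrak{F}^{(a,b)}_n=(\mathfrak{F}^{(a,b)}_{n-1})^a\,\mathfrak{F}^{(a,b)}_{n-2}$ if $n$ is even, $\mathfrak{F}^{(a,b)}_n=(\mathfrak{F}^{(a,b)}_{n-1})^b\,\mathfrak{F}^{(a,b)}_{n-2}$ if $n$ is odd. The infinite word $\mathfrak{F}^{(a,b)}=\lim_{n\to\infty}\mathfrak{F}^{(a,b)}_n$ is the unique infinite word having every $\mathfrak{F}^{(a,b)}_n$, $n\geq 1$, as a prefix. If $u$ is a factor of an infinite word $w$ and $p_0<p_1<p_2<\cdots$ are all the positions at which $u$ occurs in $w$, the return words of $u$ in $w$ are the factors $w[p_i,p_{i+1})$, $i\geq 0$ (from position $p_i$ up to but not including position $p_{i+1}$). *)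

theory Defs
  imports "HOL-Library.Omega_Words_Fun" "HOL-Library.Z2"
begin

fun fib_fword :: "nat \<Rightarrow> nat \<Rightarrow> nat \<Rightarrow> bit list" where
  "fib_fword a b 0 = [1]"
| "fib_fword a b (Suc 0) = [0]"
| "fib_fword a b (Suc (Suc n)) =
     concat (replicate (if even (Suc (Suc n)) then a else b) (fib_fword a b (Suc n)))
       @ fib_fword a b n"

(* The word of index 0 is excluded, since it is not a prefix of the later ones. *)
definition fib_word :: "nat \<Rightarrow> nat \<Rightarrow> bit word" where
  "fib_word a b =
     (THE w. \<forall>n\<ge>1. prefix (length (fib_fword a b n)) w = fib_fword a b n)"

lemma fib_fword_Suc:
  assumes "a \<ge> 1" "b \<ge> 1" "n \<ge> 1"
  shows "\<exists>v. v \<noteq> [] \<and> fib_fword a b (Suc n) = fib_fword a b n @ v"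
proof -
  have ne: "fib_fword a b k \<noteq> []" for k
    using assms(1,2) by (induction a b k rule: fib_fword.induct) auto
  obtain m where m: "n = Suc m"
    using assms(3) by (cases n) auto
  define k where "k = (if even (Suc (Suc m)) then a else b)"
  obtain j where j: "k = Suc j"
    using assms(1,2) by (cases k) (auto simp: k_def split: if_splits)
  have "fib_fword a b (Suc n) = concat (replicate k (fib_fword a b n)) @ fib_fword a b m"
    by (simp add: m k_def)
  then show ?thesis
    using ne j by auto
qed

lemma ex1_fib_word:
  assumes "a \<ge> 1" "b \<ge> 1"
  shows "\<exists>!w. \<forall>n\<ge>1. prefix (length (fib_fword a b n)) w = fib_fword a b n"
proof (rule ex_ex1I)
  let ?F = "fib_fword a b"
  have mono: "\<exists>v. ?F n = ?F m @ v" if "1 \<le> m" "m \<le> n" for m n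
    using that(2)
  proof (induction n rule: dec_induct)
    case (step k)
    then show ?case
      using fib_fword_Suc[OF assms, of k] that(1) by fastforce
  qed simp
  have len: "i < length (?F (Suc i))" for i
  proof (induction i)
    case (Suc i)
    obtain v where "v \<noteq> []" "?F (Suc (Suc i)) = ?F (Suc i) @ v"
      using fib_fword_Suc[OF assms, of "Suc i"] by auto
    moreover from this have "length v > 0"
      by simp
    ultimately show ?case
      using Suc by (simp del: fib_fword.simps length_greater_0_conv)
  qed simp
  define w where "w i = ?F (Suc i) ! i" for i
  have "w i = ?F n ! i" if "n \<ge> 1" "i < length (?F n)" for n i
  proof (cases "n \<le> Suc i")
    case True
    then show ?thesis
      using mono[OF that(1) True] that(2) by (auto simp: w_def nth_append simp del: fib_fword.simps)
  next
    case False
    then show ?thesis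
      using mono[of "Suc i" n] len[of i] by (auto simp: w_def nth_append simp del: fib_fword.simps)
  qed
  then show "\<exists>w. \<forall>n\<ge>1. prefix (length (?F n)) w = ?F n"
    by (intro exI[of _ w]) (auto intro!: nth_equalityI)
  fix v w :: "bit word"
  assume v: "\<forall>n\<ge>1. prefix (length (?F n)) v = ?F n"
    and w: "\<forall>n\<ge>1. prefix (length (?F n)) w = ?F n"
  show "v = w"
  proof
    fix i
    have "prefix (length (?F (Suc i))) v ! i = prefix (length (?F (Suc i))) w ! i"
      using v w by (simp del: fib_fword.simps subsequence_nth)
    then show "v i = w i"
      using len[of i] by (simp del: fib_fword.simps)
  qed
qed

definition occurrences :: "'a list \<Rightarrow> 'a word \<Rightarrow> nat set" where
  "occurrences u w = {p. w [p \<rightarrow> p + length u] = u}"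

(* As range p is infinite, a word with only finitely many occurrences gets no return words. *)
definition return_words :: "'a list \<Rightarrow> 'a word \<Rightarrow> 'a list set" where
  "return_words u w =
     {w [p i \<rightarrow> p (Suc i)] | p i. strict_mono p \<and> range p = occurrences u w}"

end

theory Submission
  imports Defs
begin

text \<open>
  Every word of even index at least 2 is a product of the two blocks \<open>0\<^sup>a1\<close> and \<open>0\<^bsup>a+1\<^esup>1\<close>, whose first
  block is \<open>0\<^sup>a1\<close>; every word of odd index at least 3 is such a product followed by a single \<open>0\<close>.
  This persists along the recursion because a dangling \<open>0\<close> is always followed by a product that
  begins with \<open>0\<^sup>a1\<close>, and the two merge into a block \<open>0\<^bsup>a+1\<^esup>1\<close> (\<open>block_product_append_zero\<close>).

  As each block has its only \<open>1\<close> at its end, the word that separates two consecutive occurrences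
  of \<open>1\<close> is \<open>0\<^sup>a\<close> or \<open>0\<^bsup>a+1\<^esup>\<close> (\<open>fib_word_next_one\<close>). Both really occur: the longer one at the
  junction of the words of index 3 and 2, the shorter one at the junction of the words of index 4
  and 3 (\<open>fib_fword_factors\<close>). In particular \<open>1\<close> occurs infinitely often, so its return words are
  given by the pairs of consecutive occurrences (\<open>return_words_letter\<close>).
\<close>

section \<open>Return words of a letter\<close>

text \<open>An increasing enumeration of the occurrences cannot skip one, so its consecutive values are
  exactly the pairs of occurrences with none in between. Infiniteness ensures that such an
  enumeration exists.\<close>

lemma return_words_letter:
  assumes "infinite {p. w p = c}"
  shows "return_words [c] w =
    {w [p \<rightarrow> p + Suc d] | p d. w p = c \<and> w (p + Suc d) = c \<and> (\<forall>i<d. w (p + Suc i) \<noteq> c)}"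
    (is "_ = ?R")
proof -
  let ?O = "{p. w p = c}"
  have occ: "occurrences [c] w = ?O"
    by (auto simp: occurrences_def)
  show ?thesis
  proof
    show "return_words [c] w \<subseteq> ?R"
    proof
      fix x assume "x \<in> return_words [c] w"
      then obtain f i where f: "strict_mono f" "range f = ?O" and x: "x = w [f i \<rightarrow> f (Suc i)]"
        unfolding return_words_def occ by blast
      have c: "w (f j) = c" for j
        using f(2) by blast
      obtain d where d: "f (Suc i) = f i + Suc d"
        using strict_monoD[OF f(1), of i "Suc i"] less_imp_Suc_add[of "f i"] by auto
      have "w (f i + Suc k) \<noteq> c" if "k < d" for k
      proof
        assume "w (f i + Suc k) = c"
        then obtain j where "f j = f i + Suc k"
          using f(2) by (metis (mono_tags, lifting) mem_Collect_eq rangeE)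
        then have "f i < f j" "f j < f (Suc i)"
          using d that by auto
        then show False
          using strict_mono_less[OF f(1)] by simp
      qed
      then show "x \<in> ?R"
        using x d c[of i] c[of "Suc i"] by auto
    qed
  next
    show "?R \<subseteq> return_words [c] w"
    proof
      fix x assume "x \<in> ?R"
      then obtain p d where x: "x = w [p \<rightarrow> p + Suc d]" and c: "w p = c" "w (p + Suc d) = c"
        and nc: "\<forall>i<d. w (p + Suc i) \<noteq> c"
        by blast
      let ?f = "enumerate ?O"
      have f: "strict_mono ?f" "range ?f = ?O"
        using assms by (simp_all add: strict_mono_enumerate range_enumerate)
      obtain i where i: "?f i = p"
        using f(2) c(1) by (metis (mono_tags, lifting) mem_Collect_eq rangeE)
      obtain j where j: "?f j = p + Suc d"
        using f(2) c(2) by (metis (mono_tags, lifting) mem_Collect_eq rangeE)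
      have "i < j"
        using i j strict_mono_less[OF f(1), of i j] by simp
      then have le: "?f (Suc i) \<le> p + Suc d"
        using j strict_mono_less_eq[OF f(1), of "Suc i" j] by simp
      obtain k where k: "?f (Suc i) = p + Suc k"
        using i strict_monoD[OF f(1), of i "Suc i"] less_imp_Suc_add[of p] by auto
      have "w (p + Suc k) = c"
        using k f(2) by (metis (mono_tags, lifting) mem_Collect_eq rangeI)
      then have "\<not> k < d"
        using nc by blast
      then have "?f (Suc i) = p + Suc d"
        using k le by simp
      then show "x \<in> return_words [c] w"
        unfolding return_words_def occ mem_Collect_eq using f i x
        by (intro exI[of _ ?f] exI[of _ i]) simp
    qed
  qed
qed

lemma subsequence_eq_Cons_replicate:
  assumes "w p = x" "\<And>i. i < d \<Longrightarrow> w (p + Suc i) = y"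
  shows "w [p \<rightarrow> p + Suc d] = x # replicate d y"
  using assms by (induction d) (auto simp: replicate_append_same)

section \<open>Block products\<close>

definition blocks :: "nat \<Rightarrow> bit list set" where
  "blocks a = {replicate a 0 @ [1], replicate (Suc a) 0 @ [1]}"

text \<open>The first block is required to be the short one so that a \<open>0\<close> written in front of the product
  turns it into the long one.\<close>

definition block_product :: "nat \<Rightarrow> bit list \<Rightarrow> bool" where
  "block_product a w \<longleftrightarrow> (\<exists>zs. set zs \<subseteq> blocks a \<and> w = replicate a 0 @ [1] @ concat zs)"

lemma block_product_single: "block_product a (replicate a 0 @ [1])"
  unfolding block_product_def by (intro exI[of _ "[]"]) simp

lemma block_product_append:
  assumes "block_product a u" "block_product a v"
  shows "block_product a (u @ v)"
proof -
  obtain ys zs where "set ys \<subseteq> blocks a" "u = replicate a 0 @ [1] @ concat ys"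
    "set zs \<subseteq> blocks a" "v = replicate a 0 @ [1] @ concat zs"
    using assms unfolding block_product_def by blast
  then show ?thesis
    unfolding block_product_def
    by (intro exI[of _ "ys @ (replicate a 0 @ [1]) # zs"]) (auto simp: blocks_def)
qed

lemma block_product_append_zero:
  assumes "block_product a u" "block_product a v"
  shows "block_product a (u @ [0] @ v)"
proof -
  obtain ys zs where "set ys \<subseteq> blocks a" "u = replicate a 0 @ [1] @ concat ys"
    "set zs \<subseteq> blocks a" "v = replicate a 0 @ [1] @ concat zs"
    using assms unfolding block_product_def by blast
  then show ?thesis
    unfolding block_product_def
    by (intro exI[of _ "ys @ (replicate (Suc a) 0 @ [1]) # zs"]) (auto simp: blocks_def)
qed

lemma block_product_power_append:
  assumes "block_product a u" "block_product a v"
  shows "block_product a (concat (replicate k u) @ v)"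
  using assms by (induction k) (simp_all add: block_product_append)

lemma block_product_power_append_zero:
  assumes "block_product a u" "block_product a v"
  shows "block_product a (concat (replicate k (u @ [0])) @ v)"
proof (induction k)
  case (Suc k)
  then show ?case
    using block_product_append_zero[OF assms(1) Suc] by simp
qed (simp add: assms)

lemma concat_replicate_Suc_right:
  "concat (replicate (Suc k) u) = concat (replicate k u) @ u"
  by (induction k) simp_all

text \<open>The three indices are separate variables so that the recurrence applies to numerals and to
  indices of the form \<open>2 * k + c\<close> alike.\<close>

lemma fib_fword_even:
  assumes "even n" "m = n + 1" "l = n + 2"
  shows "fib_fword a b l = concat (replicate a (fib_fword a b m)) @ fib_fword a b n"
  using assms by simp

lemma fib_fword_odd:
  assumes "odd n" "m = n + 1" "l = n + 2"
  shows "fib_fword a b l = concat (replicate b (fib_fword a b m)) @ fib_fword a b n"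
  using assms by simp

lemma fib_fword_2: "fib_fword a b 2 = replicate a 0 @ [1]"
  by (subst fib_fword_even[of 0 1]) (simp_all add: concat_replicate_single)

lemma fib_fword_3: "fib_fword a b 3 = concat (replicate b (replicate a 0 @ [1])) @ [0]"
  by (subst fib_fword_odd[of 1 2]) (simp_all add: fib_fword_2)

text \<open>The even and the odd case feed each other. A power of words \<open>v0\<close> followed by a product is
  again a product, since every dangling \<open>0\<close> is absorbed by the short block after it; a power of
  products followed by \<open>v0\<close> keeps only the last \<open>0\<close>. The induction starts at index 2 because the
  word of index 1 is a bare \<open>0\<close>, without a leading block.\<close>

lemma fib_fword_block_product:
  assumes "b \<ge> 1"
  shows "block_product a (fib_fword a b (2 * k + 2)) \<and>
    (\<exists>v. block_product a v \<and> fib_fword a b (2 * k + 3) = v @ [0])"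
proof (induction k)
  case 0
  let ?X = "replicate a 0 @ [1 :: bit]"
  obtain b' where b: "b = Suc b'"
    using assms by (cases b) auto
  have "fib_fword a b 3 = (concat (replicate b' ?X) @ ?X) @ [0]"
    unfolding fib_fword_3 b concat_replicate_Suc_right ..
  then show ?case
    using fib_fword_2 block_product_single
      block_product_power_append[OF block_product_single block_product_single]
    by (metis add_0 mult_0_right)
next
  case (Suc k)
  then obtain v where u: "block_product a (fib_fword a b (2 * k + 2))"
    and v: "block_product a v" "fib_fword a b (2 * k + 3) = v @ [0]"
    by blast
  have F4: "fib_fword a b (2 * k + 4) =
      concat (replicate a (v @ [0])) @ fib_fword a b (2 * k + 2)"
    by (subst fib_fword_even[of "2 * k + 2" "2 * k + 3"]) (simp_all add: v(2))
  have F5: "fib_fword a b (2 * k + 5) =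
      (concat (replicate b (fib_fword a b (2 * k + 4))) @ v) @ [0]"
    by (subst fib_fword_odd[of "2 * k + 3" "2 * k + 4"]) (simp_all add: v(2))
  have F4_bp: "block_product a (fib_fword a b (2 * k + 4))"
    unfolding F4 by (rule block_product_power_append_zero[OF v(1) u])
  have idx: "2 * Suc k + 2 = 2 * k + 4" "2 * Suc k + 3 = 2 * k + 5"
    by simp_all
  show ?case
    unfolding idx using F4_bp F5 block_product_power_append[OF F4_bp v(1)] by blast
qed

section \<open>Gaps between consecutive ones\<close>

text \<open>A \<open>1\<close> can only be the last letter of a block, so what follows it starts at a block boundary.\<close>

lemma concat_blocks_after_one:
  assumes "set zs \<subseteq> blocks a" "concat zs = u @ 1 # v"
  shows "\<exists>ys. set ys \<subseteq> blocks a \<and> v = concat ys"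
  using assms
proof (induction zs arbitrary: u)
  case (Cons z zs)
  obtain k where z: "z = replicate k 0 @ [1]"
    using Cons.prems(1) unfolding blocks_def by (auto simp del: replicate.simps)
  have eq: "replicate k 0 @ 1 # concat zs = u @ 1 # v"
    using Cons.prems(2) z by simp
  have "(\<exists>u'. concat zs = u' @ 1 # v) \<or> concat zs = v"
    using eq
  proof (induction k arbitrary: u)
    case 0
    then show ?case by (cases u) auto
  next
    case (Suc k)
    then show ?case by (cases u) auto
  qed
  then show ?case
    using Cons.IH Cons.prems(1) by auto
qed simp

lemma block_product_after_one:
  assumes "block_product a (u @ 1 # v)" "v \<noteq> []"
  shows "\<exists>d v'. d \<in> {a, Suc a} \<and> v = replicate d 0 @ 1 # v'"
proof -
  obtain zs where "set zs \<subseteq> blocks a" "u @ 1 # v = replicate a 0 @ [1] @ concat zs"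
    using assms(1) unfolding block_product_def by blast
  then have "set ((replicate a 0 @ [1]) # zs) \<subseteq> blocks a"
    "concat ((replicate a 0 @ [1]) # zs) = u @ 1 # v"
    by (auto simp: blocks_def)
  then obtain ys where ys: "set ys \<subseteq> blocks a" "v = concat ys"
    using concat_blocks_after_one by blast
  then show ?thesis
    using assms(2) by (cases ys) (auto simp: blocks_def)
qed

lemma fib_word_prefix:
  assumes "a \<ge> 1" "b \<ge> 1" "n \<ge> 1"
  shows "prefix (length (fib_fword a b n)) (fib_word a b) = fib_fword a b n"
  using theI'[OF ex1_fib_word[OF assms(1,2)]] assms(3) unfolding fib_word_def by blast

lemma fib_word_nth:
  assumes "a \<ge> 1" "b \<ge> 1" "n \<ge> 1" "i < length (fib_fword a b n)"
  shows "fib_word a b i = fib_fword a b n ! i"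
  using fib_word_prefix[OF assms(1-3)] assms(4)
  by (metis add_0 diff_zero subsequence_nth)

lemma fib_word_factor:
  assumes "a \<ge> 1" "b \<ge> 1" "n \<ge> 1" "fib_fword a b n = u @ x @ v" "i < length x"
  shows "fib_word a b (length u + i) = x ! i"
  using fib_word_nth[OF assms(1-3), of "length u + i"] assms(4,5) by (simp add: nth_append)

lemma length_fib_fword_ge:
  assumes "a \<ge> 1" "b \<ge> 1" "n \<ge> 1"
  shows "n \<le> length (fib_fword a b n)"
  using assms(3)
proof (induction n rule: dec_induct)
  case (step n)
  obtain v where "v \<noteq> []" "fib_fword a b (Suc n) = fib_fword a b n @ v"
    using fib_fword_Suc[OF assms(1,2)] step.hyps(1) by blast
  then show ?case
    using step.IH by (cases v) auto
qed simp

lemma fib_word_next_one: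
  assumes "a \<ge> 1" "b \<ge> 1" "fib_word a b p = 1"
  shows "\<exists>d \<in> {a, Suc a}. fib_word a b (p + Suc d) = 1 \<and> (\<forall>i<d. fib_word a b (p + Suc i) = 0)"
proof -
  \<comment> \<open>The index only has to be even and so large that p is not the last position.\<close>
  define n where "n = 2 * p + 2"
  let ?F = "fib_fword a b n"
  let ?u = "take p ?F" and ?v = "drop (Suc p) ?F"
  have n: "n \<ge> 1"
    by (simp add: n_def)
  have len: "Suc p < length ?F"
    using length_fib_fword_ge[OF assms(1,2) n] by (simp add: n_def)
  then have "?F ! p = 1"
    using fib_word_nth[OF assms(1,2) n, of p] assms(3) by simp
  then have F: "?F = ?u @ 1 # ?v"
    using id_take_nth_drop[of p ?F] len by simp
  have "block_product a ?F"
    using fib_fword_block_product[OF assms(2)] unfolding n_def by blast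
  then have "block_product a (?u @ 1 # ?v)"
    using F by simp
  moreover have "?v \<noteq> []"
    using len by simp
  ultimately obtain d v' where d: "d \<in> {a, Suc a}" and v: "?v = replicate d 0 @ 1 # v'"
    using block_product_after_one by blast
  let ?x = "1 # replicate d 0 @ [1 :: bit]"
  have "?F = ?u @ ?x @ v'"
    using F v by simp
  then have x: "fib_word a b (p + i) = ?x ! i" if "i < d + 2" for i
    using fib_word_factor[OF assms(1,2) n, of ?u ?x v' i] that len by simp
  have "fib_word a b (p + Suc d) = 1"
    using x[of "Suc d"] by (simp add: nth_append)
  moreover have "fib_word a b (p + Suc i) = 0" if "i < d" for i
    using x[of "Suc i"] that by (simp add: nth_append)
  ultimately show ?thesis
    using d by blast
qed

text \<open>The word of index 3 begins with \<open>0\<^sup>a1\<close> and ends with \<open>10\<close>. In the word of index 4 this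
  final \<open>10\<close> meets the suffix \<open>0\<^sup>a1\<close>, which gives the long gap. The word of index 4 itself ends with
  \<open>1\<close>, and in the word of index 5 it meets the beginning \<open>0\<^sup>a1\<close> of the word of index 3, which gives
  the short one. Index 5 is needed: for \<open>b = 1\<close> the word of index 4 contains only long gaps.\<close>

lemma fib_fword_factors:
  assumes "a \<ge> 1" "b \<ge> 1" "d \<in> {a, Suc a}"
  shows "\<exists>n u v. n \<ge> 1 \<and> fib_fword a b n = u @ (1 # replicate d 0 @ [1]) @ v"
proof -
  obtain a' b' where a: "a = Suc a'" and b: "b = Suc b'"
    using assms by (cases a; cases b) auto
  let ?F = "fib_fword a b" and ?X = "replicate a 0 @ [1 :: bit]"
  have F4: "?F 4 = concat (replicate a (?F 3)) @ ?X"
    by (subst fib_fword_even[of 2 3]) (simp_all add: fib_fword_2)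
  have F5: "?F 5 = concat (replicate b (?F 4)) @ ?F 3"
    by (rule fib_fword_odd) simp_all
  have F3_last: "?F 3 = concat (replicate b' ?X) @ ?X @ [0]"
    unfolding fib_fword_3 b concat_replicate_Suc_right by simp
  have F3_first: "?F 3 = ?X @ concat (replicate b' ?X) @ [0]"
    unfolding fib_fword_3 b by simp
  have F4_last: "?F 4 = concat (replicate a' (?F 3)) @ ?F 3 @ ?X"
    unfolding F4 by (subst (1) a) (simp only: concat_replicate_Suc_right append_assoc)
  have F5_last: "?F 5 = concat (replicate b' (?F 4)) @ ?F 4 @ ?F 3"
    unfolding F5 by (subst (1) b) (simp only: concat_replicate_Suc_right append_assoc)
  have "?F 4 = (concat (replicate a' (?F 3)) @ concat (replicate b' ?X) @ replicate a 0)
      @ (1 # replicate (Suc a) 0 @ [1]) @ []"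
    unfolding F4_last by (subst (2) F3_last) simp
  moreover have "?F 5 = (concat (replicate b' (?F 4)) @ concat (replicate a (?F 3)) @ replicate a 0)
      @ (1 # replicate a 0 @ [1]) @ (concat (replicate b' ?X) @ [0])"
    unfolding F5_last by (subst (2) F4, subst (2) F3_first) simp
  moreover have "(4 :: nat) \<ge> 1" "(5 :: nat) \<ge> 1"
    by simp_all
  ultimately show ?thesis
    using assms(3) by blast
qed

section \<open>The return words of 1\<close>

theorem theorem4p9:
  fixes a b :: nat
  assumes "a \<ge> 1" and "b \<ge> 1"
  shows "return_words [1] (fib_word a b) = {1 # replicate a 0, 1 # replicate (a + 1) 0}"
proof -
  let ?w = "fib_word a b"
  have realised: "\<exists>p. ?w p = 1 \<and> ?w (p + Suc d) = 1 \<and> (\<forall>i<d. ?w (p + Suc i) = 0)"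
    if d: "d \<in> {a, Suc a}" for d
  proof -
    let ?x = "1 # replicate d 0 @ [1 :: bit]"
    obtain n u v where n: "n \<ge> 1" "fib_fword a b n = u @ ?x @ v"
      using fib_fword_factors[OF assms d] by blast
    have x: "?w (length u + i) = ?x ! i" if "i < d + 2" for i
      using fib_word_factor[OF assms n] that by simp
    have "?w (length u) = 1" "?w (length u + Suc d) = 1"
      using x[of 0] x[of "Suc d"] by (simp_all add: nth_append)
    moreover have "?w (length u + Suc i) = 0" if "i < d" for i
      using x[of "Suc i"] that by (simp add: nth_append)
    ultimately show ?thesis
      by blast
  qed
  \<comment> \<open>There is an occurrence of 1, and each one is followed by a later one.\<close>
  have "infinite {p. ?w p = 1}"
  proof
    assume fin: "finite {p. ?w p = 1}"
    define m where "m = Max {p. ?w p = 1}"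
    have "m \<in> {p. ?w p = 1}"
      unfolding m_def using realised[of a] by (intro Max_in[OF fin]) auto
    then obtain d where "?w (m + Suc d) = 1"
      using fib_word_next_one[OF assms] by blast
    then have "m + Suc d \<le> m"
      unfolding m_def by (intro Max_ge[OF fin]) simp
    then show False
      by simp
  qed
  note R = return_words_letter[OF this]
  show ?thesis
  proof
    show "return_words [1] ?w \<subseteq> {1 # replicate a 0, 1 # replicate (a + 1) 0}"
    proof
      fix x assume "x \<in> return_words [1] ?w"
      then obtain p d where x: "x = ?w [p \<rightarrow> p + Suc d]" and p: "?w p = 1" "?w (p + Suc d) = 1"
        and nc: "\<forall>i<d. ?w (p + Suc i) \<noteq> 1"
        unfolding R by blast
      obtain e where e: "e \<in> {a, Suc a}" "?w (p + Suc e) = 1" "\<forall>i<e. ?w (p + Suc i) = 0"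
        using fib_word_next_one[OF assms p(1)] by blast
      have "\<not> e < d" "\<not> d < e"
        using nc e(2,3) p(2) by auto
      then have "d = e"
        by simp
      then have "x = 1 # replicate e 0"
        unfolding x by (simp only:) (use p(1) e(3) in \<open>intro subsequence_eq_Cons_replicate; simp\<close>)
      then show "x \<in> {1 # replicate a 0, 1 # replicate (a + 1) 0}"
        using e(1) by auto
    qed
  next
    have "1 # replicate d 0 \<in> return_words [1] ?w" if d: "d \<in> {a, Suc a}" for d
    proof -
      obtain p where p: "?w p = 1" "?w (p + Suc d) = 1" "\<forall>i<d. ?w (p + Suc i) = 0"
        using realised[OF d] by blast
      then have "?w [p \<rightarrow> p + Suc d] = 1 # replicate d 0"
        by (intro subsequence_eq_Cons_replicate) auto
      moreover have "\<forall>i<d. ?w (p + Suc i) \<noteq> 1"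
        using p(3) by simp
      ultimately show ?thesis
        unfolding R mem_Collect_eq using p(1,2) by (metis (no_types, lifting))
    qed
    then show "{1 # replicate a 0, 1 # replicate (a + 1) 0} \<subseteq> return_words [1] ?w"
      by (auto simp del: replicate.simps)
  qed
qed

end
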